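(* The bound function $B_{\mathrm{sq},\chi^2}$ is strictly quasi-convex on $\Delta^H$ if the following condition holds for any $Q,Q'\in\Delta^H$ and each $\alpha\in(0,1)$: $$\sqrt[4]{\frac{12m-11}{16m^3\delta}}\left[\sqrt[4]{\sum_{i=1}^H\frac{(\alpha q_i+(1-\alpha)q_i')^2}{p_i}}-\sqrt[4]{\sum_{i=1}^H\frac{q_i^2}{p_i}}\right]<(1-\alpha)\left(\mathbb{E}_Q[\hat l]-\mathbb{E}_{Q'}[\hat l]\right),$$ and hence, in that case, a local minimum of the bound minimization problem $\min_{Q\in\Delta^H}B_{\mathrm{sq},\chi^2}(Q)$ is also a global minimum.
   Context: $\Delta^H=\{(q_1,\dots,q_H):q_i\ge0,\ \sum_iq_i=1\}$. $P=(p_1,\dots,p_H)$ is a prior distribution with $p_i>0$, $\sum_ip_i=1$; $\hat l_1,\dots,\hat l_H\in[0,1]$ are empirical risks; $m\ge1$ is an integer; $\delta\in(0,1)$; $\mathbb{E}_Q[\hat l]=\sum_{i=1}^H\hat l_iq_i$. The bound function is $$B_{\mathrm{sq},\chi^2}(Q)=\sum_{i=1}^H\hat l_iq_i+\sqrt[4]{\left(\sum_{i=1}^H\frac{q_i^2}{p_i}\right)\frac{12m-11}{16m^3\delta}}.$$ A function $f:E\to\mathbb{R}$ on a non-empty convex set $E\subset\mathbb{R}^n$ is strictly quasi-convex if for all $x_1,x_2\in E$ with $f(x_1)\ne f(x_2)$ one has $f(\alpha x_1+(1-\alpha)x_2)<\max(f(x_1),f(x_2))$ for all $\alpha\in(0,1)$.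 *)

theory Defs
  imports "HOL-Analysis.Analysis"
begin

definition prob_simplex :: "(real ^ 'n) set" where
  "prob_simplex = {q. (\<forall>i. 0 \<le> q $ i) \<and> (\<Sum>i\<in>UNIV. q $ i) = 1}"

definition expected_risk :: "real ^ 'n \<Rightarrow> real ^ 'n \<Rightarrow> real" where
  "expected_risk l q = (\<Sum>i\<in>UNIV. l $ i * q $ i)"

definition bound_sq_chi2 ::
    "real ^ 'n \<Rightarrow> real ^ 'n \<Rightarrow> nat \<Rightarrow> real \<Rightarrow> real ^ 'n \<Rightarrow> real" where
  "bound_sq_chi2 p l m \<delta> q =
     (\<Sum>i\<in>UNIV. l $ i * q $ i) +
     root 4 ((\<Sum>i\<in>UNIV. (q $ i)\<^sup>2 / p $ i) * ((12 * real m - 11) / (16 * real m ^ 3 * \<delta>)))"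

definition strictly_quasi_convex_on :: "'a::euclidean_space set \<Rightarrow> ('a \<Rightarrow> real) \<Rightarrow> bool" where
  "strictly_quasi_convex_on E f \<longleftrightarrow>
     E \<noteq> {} \<and> convex E \<and>
     (\<forall>x1\<in>E. \<forall>x2\<in>E. f x1 \<noteq> f x2 \<longrightarrow>
        (\<forall>\<alpha>::real. 0 < \<alpha> \<and> \<alpha> < 1 \<longrightarrow>
           f (\<alpha> *\<^sub>R x1 + (1 - \<alpha>) *\<^sub>R x2) < max (f x1) (f x2)))"

definition local_min_on :: "'a::metric_space set \<Rightarrow> ('a \<Rightarrow> real) \<Rightarrow> 'a \<Rightarrow> bool" where
  "local_min_on S f x \<longleftrightarrow> (\<exists>\<epsilon>>0. is_arg_min f (\<lambda>y. y \<in> S \<inter> ball x \<epsilon>) x)"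

definition global_min_on :: "'a set \<Rightarrow> ('a \<Rightarrow> real) \<Rightarrow> 'a \<Rightarrow> bool" where
  "global_min_on S f x \<longleftrightarrow> is_arg_min f (\<lambda>y. y \<in> S) x"

definition sq_chi2_ineq ::
    "real ^ 'n \<Rightarrow> real ^ 'n \<Rightarrow> nat \<Rightarrow> real \<Rightarrow> real \<Rightarrow> real ^ 'n \<Rightarrow> real ^ 'n \<Rightarrow> bool" where
  "sq_chi2_ineq p l m \<delta> \<alpha> q q' \<longleftrightarrow>
     root 4 ((12 * real m - 11) / (16 * real m ^ 3 * \<delta>)) *
       (root 4 (\<Sum>i\<in>UNIV. (\<alpha> * q $ i + (1 - \<alpha>) * q' $ i)\<^sup>2 / p $ i) -
        root 4 (\<Sum>i\<in>UNIV. (q $ i)\<^sup>2 / p $ i))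
     < (1 - \<alpha>) * (expected_risk l q - expected_risk l q')"

text \<open>
  The inequality is asymmetric in \<open>q\<close> and \<open>q'\<close>: up to the factorisation of the fourth root it
  says that the bound at the mixture lies below the bound at \<open>q\<close>. So it can only be demanded of
  pairs in which \<open>q\<close> has the larger bound. Demanded of all pairs it is contradictory, as the
  pair \<open>q = q'\<close> shows; excluding only \<open>q = q'\<close> does not help, because the inequality fails
  whenever \<open>q\<close> is a global minimiser of the bound. The condition is therefore imposed on all
  ordered pairs with \<open>bound q' < bound q\<close>. It is then weaker than the unrestricted one, and
  satisfiable, for example by constant risks.
\<close>

definition sq_chi2_condition ::
    "real ^ 'n \<Rightarrow> real ^ 'n \<Rightarrow> nat \<Rightarrow> real \<Rightarrow> bool" where
  "sq_chi2_condition p l m \<delta> \<longleftrightarrow>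
     (\<forall>q\<in>prob_simplex. \<forall>q'\<in>prob_simplex.
        bound_sq_chi2 p l m \<delta> q' < bound_sq_chi2 p l m \<delta> q \<longrightarrow>
        (\<forall>\<alpha>. 0 < \<alpha> \<and> \<alpha> < 1 \<longrightarrow> sq_chi2_ineq p l m \<delta> \<alpha> q q'))"

lemma unrestricted_imp_sq_chi2_condition:
  assumes "\<And>q q' \<alpha>. q \<in> prob_simplex \<Longrightarrow> q' \<in> prob_simplex \<Longrightarrow> 0 < \<alpha> \<Longrightarrow> \<alpha> < 1 \<Longrightarrow>
             sq_chi2_ineq p l m \<delta> \<alpha> q q'"
  shows "sq_chi2_condition p l m \<delta>"
  using assms by (simp add: sq_chi2_condition_def)

lemma sq_chi2_ineq_same: "\<not> sq_chi2_ineq p l m \<delta> \<alpha> q q"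
proof -
  have "\<alpha> * q $ i + (1 - \<alpha>) * q $ i = q $ i" for i
    by (simp add: algebra_simps)
  then show ?thesis by (simp add: sq_chi2_ineq_def)
qed

lemma sq_chi2_condition_const:
  fixes p l :: "real ^ 'n"
  assumes p: "\<And>i. 0 < p $ i" and l: "\<And>i. l $ i = c" and m: "1 \<le> m" and d: "0 < \<delta>"
  shows "sq_chi2_condition p l m \<delta>"
  unfolding sq_chi2_condition_def
proof (intro ballI impI allI)
  fix q q' :: "real ^ 'n" and \<alpha> :: real
  assume q: "q \<in> prob_simplex" and q': "q' \<in> prob_simplex"
    and lt: "bound_sq_chi2 p l m \<delta> q' < bound_sq_chi2 p l m \<delta> q" and a: "0 < \<alpha> \<and> \<alpha> < 1"
  define K where "K = (12 * real m - 11) / (16 * real m ^ 3 * \<delta>)"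
  define N where "N x = (\<Sum>i\<in>UNIV. (x $ i)\<^sup>2 / p $ i)" for x :: "real ^ 'n"
  have K: "K > 0" using m d by (simp add: K_def)
  have lc: "(\<Sum>i\<in>UNIV. l $ i * x $ i) = c" if "x \<in> prob_simplex" for x
    using that by (simp add: l prob_simplex_def flip: sum_distrib_left)
  have "N q' < N q"
    using lt K by (simp add: bound_sq_chi2_def lc q q' flip: K_def N_def)
  have "(\<alpha> * q $ i + (1 - \<alpha>) * q' $ i)\<^sup>2 / p $ i
          \<le> \<alpha> * ((q $ i)\<^sup>2 / p $ i) + (1 - \<alpha>) * ((q' $ i)\<^sup>2 / p $ i)" for i
  proof -
    have "0 \<le> \<alpha> * (1 - \<alpha>) * (q $ i - q' $ i)\<^sup>2" using a by simp
    then have "(\<alpha> * q $ i + (1 - \<alpha>) * q' $ i)\<^sup>2 \<le> \<alpha> * (q $ i)\<^sup>2 + (1 - \<alpha>) * (q' $ i)\<^sup>2"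
      by (simp add: power2_eq_square algebra_simps)
    from divide_right_mono[OF this less_imp_le[OF p[of i]]] show ?thesis
      by (simp add: add_divide_distrib)
  qed
  then have "(\<Sum>i\<in>UNIV. (\<alpha> * q $ i + (1 - \<alpha>) * q' $ i)\<^sup>2 / p $ i) \<le> \<alpha> * N q + (1 - \<alpha>) * N q'"
    unfolding N_def sum_distrib_left sum.distrib[symmetric] by (rule sum_mono)
  also have "\<dots> < \<alpha> * N q + (1 - \<alpha>) * N q" using a \<open>N q' < N q\<close> by simp
  also have "\<dots> = N q" by (simp add: algebra_simps)
  finally have "root 4 (\<Sum>i\<in>UNIV. (\<alpha> * q $ i + (1 - \<alpha>) * q' $ i)\<^sup>2 / p $ i) < root 4 (N q)"
    by simp
  then show "sq_chi2_ineq p l m \<delta> \<alpha> q q'"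
    using K by (simp add: sq_chi2_ineq_def expected_risk_def lc q q' mult_less_0_iff
        flip: K_def N_def)
qed

end

theory Submission
  imports Defs
begin

text \<open>
  The expected risk is affine in the posterior and the fourth root is multiplicative, so
  \<open>sq_chi2_ineq p l m \<delta> \<alpha> q q'\<close> is a rearrangement of the statement that the bound at
  \<open>\<alpha> q + (1 - \<alpha>) q'\<close> lies strictly below the bound at \<open>q\<close>
  (\<open>sq_chi2_ineq_iff_bound_less\<close>). When the bound differs at \<open>q\<close> and \<open>q'\<close>, naming
  \<open>q\<close> the point with the larger bound turns this into the defining inequality of strict
  quasi-convexity; as the mixture is symmetric under exchanging the points together with the
  weights, this orientation loses nothing.

  Local minima are global for every strictly quasi-convex function
  (\<open>strictly_quasi_convex_local_min_imp_global_min\<close>): on the segment from a point \<open>x\<close> to a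
  strictly better one, all interior points are strictly better than \<open>x\<close>, and they come
  arbitrarily close to it.
\<close>

lemma strictly_quasi_convex_onI:
  assumes "E \<noteq> {}" "convex E"
    and less: "\<And>x y \<alpha>. x \<in> E \<Longrightarrow> y \<in> E \<Longrightarrow> f y < f x \<Longrightarrow> 0 < \<alpha> \<Longrightarrow> \<alpha> < 1 \<Longrightarrow>
                 f (\<alpha> *\<^sub>R x + (1 - \<alpha>) *\<^sub>R y) < f x"
  shows "strictly_quasi_convex_on E f"
  unfolding strictly_quasi_convex_on_def
proof (intro conjI ballI impI allI)
  fix x y and \<alpha> :: real
  assume E: "x \<in> E" "y \<in> E" and "f x \<noteq> f y" and \<alpha>: "0 < \<alpha> \<and> \<alpha> < 1"
  from \<open>f x \<noteq> f y\<close> consider "f y < f x" | "f x < f y" by linarith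
  then show "f (\<alpha> *\<^sub>R x + (1 - \<alpha>) *\<^sub>R y) < max (f x) (f y)"
  proof cases
    case 1
    with less[of x y \<alpha>] E \<alpha> show ?thesis by simp
  next
    case 2
    with less[of y x "1 - \<alpha>"] E \<alpha> show ?thesis by (simp add: add.commute)
  qed
qed (use assms in auto)

lemma strictly_quasi_convex_local_min_imp_global_min:
  fixes f :: "'a::euclidean_space \<Rightarrow> real"
  assumes sqc: "strictly_quasi_convex_on E f" and local: "local_min_on E f x"
  shows "global_min_on E f x"
proof -
  from local obtain \<epsilon> where \<epsilon>: "\<epsilon> > 0" and x: "x \<in> E"
    and min: "\<And>z. z \<in> E \<Longrightarrow> dist x z < \<epsilon> \<Longrightarrow> f x \<le> f z"
    unfolding local_min_on_def is_arg_min_def by (force simp: not_less)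
  have "f x \<le> f y" if y: "y \<in> E" for y
  proof (rule ccontr)
    assume "\<not> f x \<le> f y"
    then have less: "f y < f x" by simp
    then have pos: "dist x y > 0" by auto
    \<comment> \<open>The weight of \<open>y\<close> is small enough that the mixture stays in the \<open>\<epsilon>\<close>-ball around
      \<open>x\<close>, and at most \<open>1/2\<close>, so that it is a proper mixture.\<close>
    define \<beta> where "\<beta> = min (1/2) (\<epsilon> / (2 * dist x y))"
    have \<beta>: "0 < \<beta>" "\<beta> < 1" using \<epsilon> pos by (auto simp: \<beta>_def)
    define z where "z = (1 - \<beta>) *\<^sub>R x + (1 - (1 - \<beta>)) *\<^sub>R y"
    have "z \<in> E"
      using sqc x y \<beta> unfolding strictly_quasi_convex_on_def z_def by (auto intro!: convexD)
    moreover have "dist x z < \<epsilon>"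
    proof -
      have "x - z = \<beta> *\<^sub>R (x - y)" by (simp add: z_def algebra_simps)
      then have "dist x z = \<beta> * dist x y" using \<beta> by (simp add: dist_norm)
      also have "\<dots> \<le> \<epsilon> / (2 * dist x y) * dist x y"
        by (intro mult_right_mono) (auto simp: \<beta>_def)
      also have "\<dots> < \<epsilon>" using \<epsilon> pos by simp
      finally show ?thesis .
    qed
    moreover have "f z < max (f x) (f y)"
    proof -
      have "f x \<noteq> f y" "0 < 1 - \<beta> \<and> 1 - \<beta> < 1" using less \<beta> by auto
      with sqc x y show ?thesis unfolding strictly_quasi_convex_on_def z_def by blast
    qed
    ultimately show False using min[of z] less by simp
  qed
  with x show ?thesis by (auto simp: global_min_on_def is_arg_min_def not_less)
qed

lemma prob_simplex_nonempty: "(prob_simplex :: (real ^ 'n) set) \<noteq> {}"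
proof -
  have "(axis undefined 1 :: real ^ 'n) \<in> prob_simplex"
    by (simp add: prob_simplex_def axis_def)
  then show ?thesis by blast
qed

lemma convex_prob_simplex: "convex prob_simplex"
  by (rule convexI) (simp add: prob_simplex_def sum.distrib flip: sum_distrib_left)

lemma expected_risk_mixture:
  "expected_risk l (a *\<^sub>R q + b *\<^sub>R q') = a * expected_risk l q + b * expected_risk l q'"
  by (simp add: expected_risk_def sum.distrib sum_distrib_left algebra_simps)

lemma bound_sq_chi2_eq:
  "bound_sq_chi2 p l m \<delta> q =
     expected_risk l q +
     root 4 ((12 * real m - 11) / (16 * real m ^ 3 * \<delta>)) * root 4 (\<Sum>i\<in>UNIV. (q $ i)\<^sup>2 / p $ i)"
  by (simp only: bound_sq_chi2_def expected_risk_def real_root_mult mult.commute)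

text \<open>
  The right-hand side \<open>(1 - \<alpha>) (E q - E q')\<close> of the condition is exactly the decrease of the
  expected risk \<open>E\<close> in passing from \<open>q\<close> to the mixture, and the left-hand side is the
  accompanying increase of the divergence term.
\<close>

lemma sq_chi2_ineq_iff_bound_less:
  "sq_chi2_ineq p l m \<delta> \<alpha> q q' \<longleftrightarrow>
     bound_sq_chi2 p l m \<delta> (\<alpha> *\<^sub>R q + (1 - \<alpha>) *\<^sub>R q') < bound_sq_chi2 p l m \<delta> q"
proof -
  define k where "k = root 4 ((12 * real m - 11) / (16 * real m ^ 3 * \<delta>))"
  show ?thesis
    unfolding sq_chi2_ineq_def bound_sq_chi2_eq expected_risk_mixture k_def[symmetric]
    by (simp add: algebra_simps)
qed

theorem proposition1:
  fixes p l :: "real ^ 'n" and m :: nat and \<delta> :: real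
  assumes prior: "\<And>i. 0 < p $ i" "(\<Sum>i\<in>UNIV. p $ i) = 1"
    and risks: "\<And>i. 0 \<le> l $ i \<and> l $ i \<le> 1"
    and m: "1 \<le> m"
    and \<delta>: "0 < \<delta>" "\<delta> < 1"
    and condition: "sq_chi2_condition p l m \<delta>"
  shows "strictly_quasi_convex_on prob_simplex (bound_sq_chi2 p l m \<delta>) \<and>
    (\<forall>q. local_min_on prob_simplex (bound_sq_chi2 p l m \<delta>) q \<longrightarrow>
         global_min_on prob_simplex (bound_sq_chi2 p l m \<delta>) q)"
proof -
  have "strictly_quasi_convex_on prob_simplex (bound_sq_chi2 p l m \<delta>)"
    using condition
    by (intro strictly_quasi_convex_onI prob_simplex_nonempty convex_prob_simplex)
      (auto simp: sq_chi2_condition_def sq_chi2_ineq_iff_bound_less)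
  then show ?thesis
    using strictly_quasi_convex_local_min_imp_global_min by blast
qed

end
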